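(* The complete list of permutation polynomials of $\mathbb{F}_{3^2}$ of the form \[ f(x)=x^6+a_4x^4+a_3x^3+a_2x^2+a_1x \qquad (a_1,a_2,a_3,a_4\in\mathbb{F}_{3^2}) \] is given by \[ x^6+a^2x^4+a^7bx^3+a^4x^2+a(2b+1)x, \] where $a\in\mathbb{F}_{3^2}$, $a\neq 0$, and $b\in\{0,1,2^{1/2},1+2^{1/2}\}$.
   Context: A polynomial $f\in\mathbb{F}_q[x]$ is a permutation polynomial of $\mathbb{F}_q$ if $c\mapsto f(c)$ is a permutation of $\mathbb{F}_q$. The symbol $2^{1/2}$ stands for either solution of $x^2-2=0$ in $\mathbb{F}_{3^2}$; both choices are allowed. *)

theory Defs
  imports "HOL-Computational_Algebra.Polynomial" "HOL-Library.Cardinality"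
begin

definition permutation_polynomial :: "'a::{field,finite} poly \<Rightarrow> bool" where
  "permutation_polynomial f \<longleftrightarrow> bij (poly f)"

end

theory Submission
  imports Defs
begin

text \<open>
  By Hermite's criterion, the power sums of degree 2 and 4 of the values of a permutation
  polynomial of the given form vanish; this forces \<open>a\<^sub>2 = a\<^sub>4\<^sup>2\<close> and \<open>a\<^sub>4\<^sup>4 = 1\<close>, so that
  \<open>a\<^sub>4 = a\<^sup>2\<close> is a square. Rescaling the variable by \<open>a\<close> leaves
  \<open>g(x) = x\<^sup>6 + x\<^sup>4 + b x\<^sup>3 + x\<^sup>2 + c x\<close>. Write the field as \<open>F \<oplus> F i\<close> with \<open>i\<^sup>2 = -1\<close> and
  \<open>F\<close> the prime field. Then \<open>g(x + k i) = x u + k v - k\<^sup>2\<close> with \<open>u = b + c\<close>,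
  \<open>v = i (c - b)\<close>. If \<open>u\<close> is not in \<open>F\<close>, the three cosets of \<open>F u\<close> represented by
  \<open>0\<close>, \<open>v - 1\<close>, \<open>-v - 1\<close> cannot be distinct, since 1 spans the quotient by \<open>F u\<close>. Hence
  \<open>g\<close> is a permutation if and only if \<open>u = \<plusminus>1\<close> and \<open>v\<close> is not in \<open>F\<close>.
\<close>

section \<open>Power sums over finite fields\<close>

text \<open>Translation by 1 permutes the ring, so adding 1 to every summand leaves the sum over all
  elements unchanged.\<close>

lemma of_nat_card_eq_0: "of_nat CARD('a::{ring_1,finite}) = (0::'a)"
proof -
  have "(\<Sum>x\<in>UNIV. x + 1) = (\<Sum>x\<in>UNIV. x :: 'a)"
    by (rule sum.reindex_bij_witness[of _ "\<lambda>x. x - 1" "\<lambda>x. x + 1"]) auto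
  then show ?thesis
    by (simp add: sum.distrib)
qed

text \<open>Multiplication by \<open>x\<close> permutes the nonzero elements; their product is
  nonzero and can be cancelled.\<close>

lemma power_card_minus_1_eq_1:
  fixes x :: "'a::{field,finite}"
  assumes "x \<noteq> 0"
  shows "x ^ (CARD('a) - 1) = 1"
proof -
  have "(\<Prod>y\<in>UNIV - {0}. x * y) = (\<Prod>y\<in>UNIV - {0}. y :: 'a)"
    by (rule prod.reindex_bij_witness[of _ "\<lambda>y. y / x" "\<lambda>y. x * y"]) (use assms in auto)
  moreover have "(\<Prod>y\<in>UNIV - {0::'a}. y) \<noteq> 0"
    by simp
  ultimately show ?thesis
    by (simp add: prod.distrib card_Diff_singleton)
qed

lemma power_card_eq_self:
  fixes x :: "'a::{field,finite}"
  shows "x ^ CARD('a) = x"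
proof (cases "x = 0")
  case False
  have "x ^ CARD('a) = x * x ^ (CARD('a) - 1)"
    by (metis zero_less_card_finite power_minus_mult mult.commute)
  with False show ?thesis
    using power_card_minus_1_eq_1[OF False] by simp
qed simp

text \<open>The polynomial X^k - 1 has at most \<open>k\<close> roots, fewer than there are nonzero
  elements. Such an element stands in for a generator of the multiplicative group.\<close>

lemma ex_power_neq_1:
  assumes "0 < k" and "k < CARD('a::{field,finite}) - 1"
  obtains g :: "'a::{field,finite}" where "g \<noteq> 0" and "g ^ k \<noteq> 1"
proof -
  let ?p = "monom 1 k - 1 :: 'a poly"
  have deg: "degree ?p \<le> k"
    by (intro degree_diff_le) (auto simp: degree_monom_le)
  have "coeff ?p k = 1"
    using assms(1) by simp
  then have "?p \<noteq> 0"
    by (metis coeff_0 zero_neq_one)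
  have "card {x. poly ?p x = 0} \<le> k"
    using card_poly_roots_bound[OF \<open>?p \<noteq> 0\<close>] deg by linarith
  moreover have "card (UNIV - {0::'a}) = CARD('a) - 1"
    by (simp add: card_Diff_singleton)
  ultimately have "\<not> UNIV - {0} \<subseteq> {x. poly ?p x = 0}"
    using assms(2) by (metis card_mono finite leD le_trans)
  then show thesis
    using that by (auto simp: poly_monom)
qed

text \<open>Replacing x by g x multiplies the sum by \<open>g ^ k\<close>, which can be chosen
  different from 1. For \<open>k = 0\<close> every summand is 1, including the one at 0.\<close>

lemma sum_power_eq_0:
  assumes "k < CARD('a::{field,finite}) - 1"
  shows "(\<Sum>x\<in>UNIV. x ^ k) = (0::'a)"
proof (cases "k = 0")
  case True
  then show ?thesis
    by (simp add: of_nat_card_eq_0)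
next
  case False
  with assms obtain g :: 'a where g: "g \<noteq> 0" "g ^ k \<noteq> 1"
    using ex_power_neq_1 by blast
  have "(\<Sum>x\<in>UNIV. (g * x) ^ k) = (\<Sum>x\<in>UNIV. x ^ k)"
    by (rule sum.reindex_bij_witness[of _ "\<lambda>y. y / g" "\<lambda>y. g * y"]) (use g in auto)
  then have "(g ^ k - 1) * (\<Sum>x\<in>UNIV. x ^ k) = 0"
    by (simp add: power_mult_distrib left_diff_distrib flip: sum_distrib_left)
  with g show ?thesis
    by simp
qed

lemma sum_power_card_minus_1:
  "(\<Sum>x\<in>UNIV. x ^ (CARD('a) - 1)) = (- 1 :: 'a::{field,finite})"
proof -
  have "CARD('a) \<ge> 2"
    using card_mono[of UNIV "{0, 1 :: 'a}"] by simp
  have "(\<Sum>x\<in>UNIV. x ^ (CARD('a) - 1)) = (\<Sum>x\<in>UNIV - {0::'a}. x ^ (CARD('a) - 1))"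
    using \<open>CARD('a) \<ge> 2\<close> by (intro sum.mono_neutral_right) auto
  also have "\<dots> = (\<Sum>x\<in>UNIV - {0::'a}. 1)"
    by (intro sum.cong refl power_card_minus_1_eq_1) simp
  also have "\<dots> = of_nat CARD('a) - 1"
    using \<open>CARD('a) \<ge> 2\<close> by (simp add: card_Diff_singleton of_nat_diff)
  finally show ?thesis
    by (simp add: of_nat_card_eq_0)
qed

text \<open>Summing monomial by monomial, only the exponent \<open>CARD('a) - 1\<close> has a
  nonzero power sum, namely -1.\<close>

lemma sum_poly_eq_neg_coeff:
  fixes p :: "'a::{field,finite} poly"
  assumes "degree p \<le> CARD('a) - 1"
  shows "(\<Sum>x\<in>UNIV. poly p x) = - coeff p (CARD('a) - 1)"
proof -
  let ?n = "CARD('a) - 1"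
  have "(\<Sum>x\<in>UNIV. poly p x) = (\<Sum>x\<in>UNIV. \<Sum>k\<le>?n. coeff p k * x ^ k)"
    by (subst (1) poly_as_sum_of_monoms'[OF assms, symmetric]) (simp add: poly_sum poly_monom)
  also have "\<dots> = (\<Sum>k\<le>?n. coeff p k * (\<Sum>x\<in>UNIV. x ^ k))"
    by (subst sum.swap) (simp add: sum_distrib_left)
  also have "\<dots> = (\<Sum>k\<in>{?n}. coeff p k * (\<Sum>x\<in>UNIV. x ^ k))"
    by (intro sum.mono_neutral_right) (auto simp: sum_power_eq_0)
  finally show ?thesis
    using sum_power_card_minus_1[where 'a = 'a] by simp
qed

text \<open>The necessary half of Hermite's criterion: a bijection merely reorders the power sum
  over the field.\<close>

lemma bij_imp_sum_power_eq_0: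
  fixes f :: "'a::{field,finite} \<Rightarrow> 'a"
  assumes "bij f" and "k < CARD('a) - 1"
  shows "(\<Sum>x\<in>UNIV. f x ^ k) = 0"
  using sum.reindex_bij_betw[of f UNIV UNIV "\<lambda>y. y ^ k"] assms sum_power_eq_0 by simp

section \<open>The field with nine elements\<close>

lemma three_eq_0:
  assumes "CARD('a::{field,finite}) = 9"
  shows "(3::'a) = 0"
proof -
  have "(3::'a) * 3 = 0"
    using of_nat_card_eq_0[where 'a='a] assms by simp
  then show ?thesis
    by (simp only: mult_eq_0_iff disj_absorb)
qed

text \<open>An equation valid only modulo 3 becomes an identity without use of the characteristic
  once the quotient \<open>w\<close> by 3 is named; each use supplies it.\<close>

lemma char_3_eqI:
  fixes x y w :: "'a::ring_1"
  assumes "(3::'a) = 0" and "x - y = 3 * w"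
  shows "x = y"
  using assms by simp

lemma minus_eq_self_iff:
  fixes x :: "'a::ring_1"
  assumes "(3::'a) = 0"
  shows "- x = x \<longleftrightarrow> x = 0"
proof
  assume "- x = x"
  then have "x + x = 0"
    by (metis add.right_inverse)
  moreover have "3 * x = (x + x) + x"
    by (metis mult_2 mult_1_left distrib_right numeral_One numeral_plus_one semiring_norm(5))
  ultimately show "x = 0"
    using assms by simp
qed simp

lemma cube_add:
  fixes x y :: "'a::idom"
  assumes "(3::'a) = 0"
  shows "(x + y) ^ 3 = x ^ 3 + y ^ 3"
proof -
  have "(x + y) ^ 3 = x ^ 3 + y ^ 3 + 3 * (x\<^sup>2 * y + x * y\<^sup>2)"
    by algebra
  with assms show ?thesis
    by simp
qed

lemma cube_diff:
  fixes x y :: "'a::idom"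
  assumes "(3::'a) = 0"
  shows "(x - y) ^ 3 = x ^ 3 - y ^ 3"
  using cube_add[OF assms, of x "- y"] by simp

text \<open>In characteristic 3 these are the elements of the prime field. The fixed-point form is
  convenient because cubing is then a ring homomorphism.\<close>

lemma cube_eq_self_iff:
  fixes x :: "'a::idom"
  shows "x ^ 3 = x \<longleftrightarrow> x \<in> {0, 1, - 1}"
proof -
  have "x ^ 3 - x = x * ((x - 1) * (x + 1))"
    by algebra
  then have "x ^ 3 = x \<longleftrightarrow> x * ((x - 1) * (x + 1)) = 0"
    by (metis eq_iff_diff_eq_0)
  then show ?thesis
    by (auto simp: eq_neg_iff_add_eq_0)
qed

text \<open>If \<open>g ^ 8 = 1\<close> but \<open>g ^ 4\<close> is not 1, then
  \<open>g ^ 4 = - 1\<close>, and the square of \<open>g\<close> is the desired root.\<close>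

lemma imaginary_unit_exists:
  assumes "CARD('a::{field,finite}) = 9"
  obtains i :: "'a::{field,finite}" where "i\<^sup>2 = - 1"
proof -
  obtain g :: 'a where g: "g \<noteq> 0" "g ^ 4 \<noteq> 1"
    using ex_power_neq_1[of 4, where 'a = 'a] assms by auto
  have "g ^ 8 = 1"
    using power_card_minus_1_eq_1[OF g(1)] assms by simp
  then have "(g ^ 4 - 1) * (g ^ 4 + 1) = 0"
    by algebra
  with g have "(g\<^sup>2)\<^sup>2 = - 1"
    by (simp add: eq_neg_iff_add_eq_0)
  then show thesis
    by (rule that)
qed

text \<open>Cubing sends \<open>i\<close> to \<open>- i\<close>, so it acts as conjugation:
  \<open>z ^ 3 = x - k * i\<close>. Solving for the coordinates with 2 = -1 gives
  \<open>x = - (z + z ^ 3)\<close> and \<open>k = i * (z - z ^ 3)\<close>.\<close>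

lemma square_add_1_coordinates:
  fixes i z :: "'a::{field,finite}"
  assumes "CARD('a) = 9" and "i\<^sup>2 = - 1"
  obtains x k where "x ^ 3 = x" "k ^ 3 = k" "z = x + k * i"
proof
  have 3: "(3::'a) = 0"
    using assms(1) by (rule three_eq_0)
  have z9: "(z ^ 3) ^ 3 = z"
    using power_card_eq_self[of z] assms(1) by (simp flip: power_mult)
  then have add: "(z + z ^ 3) ^ 3 = z ^ 3 + z" and diff: "(z - z ^ 3) ^ 3 = z ^ 3 - z"
    by (simp_all add: cube_add[OF 3] cube_diff[OF 3])
  show "(- (z + z ^ 3)) ^ 3 = - (z + z ^ 3)"
    by (simp only: power_minus_odd[of 3, OF odd_numeral] add) (simp add: add.commute)
  show "(i * (z - z ^ 3)) ^ 3 = i * (z - z ^ 3)"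
    unfolding power_mult_distrib diff using assms(2) by algebra
  show "z = - (z + z ^ 3) + i * (z - z ^ 3) * i"
    by (rule char_3_eqI[OF 3, of _ _ z]) (use assms(2) in algebra)
qed

section \<open>Permutation polynomials\<close>

text \<open>With the conjugate w = \<open>z ^ 3\<close>, the terms of even degree are w^2 + w z +
  z^2, which equals (w - z)^2 modulo 3, that is \<open>- k\<^sup>2\<close>. The remaining terms are
  linear in \<open>x\<close> and \<open>k\<close>.\<close>

lemma normal_form_value:
  fixes b c i k x :: "'a::idom"
  assumes "(3::'a) = 0" and "i\<^sup>2 = - 1" and "x ^ 3 = x" and "k ^ 3 = k"
  defines "z \<equiv> x + k * i"
  shows "z ^ 6 + z ^ 4 + b * z ^ 3 + z ^ 2 + c * z = x * (b + c) + k * (i * (c - b)) - k\<^sup>2"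
proof -
  have z3: "z ^ 3 = x - k * i"
    unfolding z_def cube_add[OF assms(1)] using assms(2-4) by algebra
  have "z ^ 6 + z ^ 4 + b * z ^ 3 + z ^ 2 + c * z
      = (z ^ 3)\<^sup>2 + z ^ 3 * z + b * z ^ 3 + z ^ 2 + c * z"
    by algebra
  also have "\<dots> = x * (b + c) + k * (i * (c - b)) - k\<^sup>2"
    unfolding z3 unfolding z_def
    by (rule char_3_eqI[OF assms(1), of _ _ "x\<^sup>2"]) (use assms(2) in algebra)
  finally show ?thesis .
qed

text \<open>For fixed \<open>k\<close> the values lie in one coset of the prime-field multiples of
  \<open>U\<close>, represented by \<open>k * V - k\<^sup>2\<close>. Bijectivity means that
  \<open>U\<close> is nonzero and the three cosets differ; if \<open>U\<close> is 1 or -1, they are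
  the classes of 0, \<open>V\<close> and \<open>- V\<close> modulo the prime field.\<close>

lemma bij_normal_form_iff:
  fixes b c i :: "'a::{field,finite}"
  assumes card: "CARD('a) = 9" and i: "i\<^sup>2 = - 1"
  shows "bij (\<lambda>x. x ^ 6 + x ^ 4 + b * x ^ 3 + x ^ 2 + c * x)
    \<longleftrightarrow> (b + c)\<^sup>2 = 1 \<and> (i * (c - b)) ^ 3 \<noteq> i * (c - b)"
    (is "bij ?g \<longleftrightarrow> _")
proof -
  define U V where "U = b + c" and "V = i * (c - b)"
  have 3: "(3::'a) = 0"
    using card by (rule three_eq_0)
  note val = normal_form_value[OF 3 i, where b = b and c = c, folded U_def V_def]
  have i_notin: "i ^ 3 \<noteq> i" "i \<noteq> 0"
  proof -
    show "i \<noteq> 0"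
      using i by auto
    show "i ^ 3 \<noteq> i"
    proof
      assume "i ^ 3 = i"
      moreover have "i ^ 3 = - i"
        using i by (simp add: power3_eq_cube power2_eq_square)
      ultimately have "i = 0"
        using minus_eq_self_iff[OF 3] by simp
      with \<open>i \<noteq> 0\<close> show False ..
    qed
  qed
  have "bij ?g \<longleftrightarrow> U\<^sup>2 = 1 \<and> V ^ 3 \<noteq> V"
  proof
    assume "bij ?g"
    then have inj: "?g x = ?g y \<Longrightarrow> x = y" for x y
      by (meson bij_def injD)
    have "U \<noteq> 0"
      using inj[of 0 1] val[of 0 0] val[of 1 0] by auto
    have "U ^ 3 = U"
    proof (rule ccontr)
      assume "U ^ 3 \<noteq> U"
      obtain m n where u: "m ^ 3 = m" "n ^ 3 = n" "U = m + n * i"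
        using square_add_1_coordinates[OF card i] .
      obtain p' q' where v: "p' ^ 3 = p'" "q' ^ 3 = q'" "V = p' + q' * i"
        using square_add_1_coordinates[OF card i] .
      from \<open>U ^ 3 \<noteq> U\<close> u have "n \<noteq> 0"
        by auto
      with u(2) have n2: "n\<^sup>2 = 1"
        by (auto simp: cube_eq_self_iff)
      \<comment> \<open>Coordinates of \<open>V\<close> in the basis 1, \<open>U\<close>: since
        \<open>n\<^sup>2 = 1\<close>, one has \<open>i = n * (U - m)\<close>, which is substituted
        into \<open>p' + q' * i\<close>.\<close>
      define p q where "p = p' - q' * n * m" and "q = q' * n"
      have q: "q ^ 3 = q"
        unfolding q_def by (simp only: power_mult_distrib u(2) v(2))
      have p: "p ^ 3 = p"
        unfolding p_def by (simp only: cube_diff[OF 3] power_mult_distrib u(1,2) v(1,2))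
      have v_eq: "V = p + q * U"
        unfolding p_def q_def u(3) v(3) using n2 by algebra
      \<comment> \<open>Each value of \<open>p\<close> makes two cosets coincide: those of
        \<open>k\<close> = 1 and -1 for \<open>p = 0\<close>, of 1 and 0 for \<open>p = 1\<close>,
        of -1 and 0 for \<open>p = - 1\<close>. The resulting collision would put \<open>i\<close>
        in the prime field.\<close>
      from p consider "p = 0" | "p = 1" | "p = - 1"
        by (auto simp: cube_eq_self_iff)
      then show False
      proof cases
        case 1
        have "?g (0 + 1 * i) = ?g (- q + (- 1) * i)"
          by (subst (1 2) val, simp_all add: q)
            (rule char_3_eqI[OF 3, of _ _ "q * U"], use v_eq 1 in algebra)
        then have eq: "0 + 1 * i = - q + (- 1) * i"
          by (rule inj)
        have "i = q"
          by (rule char_3_eqI[OF 3, of _ _ i]) (use eq in algebra)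
        with q i_notin show False
          by simp
      next
        case 2
        have "?g (0 + 1 * i) = ?g (q + 0 * i)"
          using q v_eq 2 by (subst (1 2) val) simp_all
        then have "0 + 1 * i = q + 0 * i"
          by (rule inj)
        with q i_notin show False
          by simp
      next
        case 3
        have "?g (0 + (- 1) * i) = ?g (- q + 0 * i)"
          using q v_eq 3 by (subst (1 2) val) simp_all
        then have "0 + (- 1) * i = - q + 0 * i"
          by (rule inj)
        with q i_notin show False
          by simp
      qed
    qed
    with \<open>U \<noteq> 0\<close> have u2: "U\<^sup>2 = 1"
      unfolding cube_eq_self_iff by (metis insertE empty_iff power2_minus power_one)
    moreover have "V ^ 3 \<noteq> V"
    proof
      assume v: "V ^ 3 = V"
      \<comment> \<open>As \<open>U\<close> is its own inverse, this \<open>y\<close> solves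
        \<open>y * U = V - 1\<close>, so the prime-field element \<open>y\<close> takes the same
        value as \<open>i\<close>.\<close>
      define y where "y = U * (V - 1)"
      have y: "y ^ 3 = y"
        unfolding y_def
        by (simp only: cube_diff[OF 3] power_mult_distrib \<open>U ^ 3 = U\<close> v power_one)
      have "y * U = V - 1"
        unfolding y_def using u2 by algebra
      then have "?g (0 + 1 * i) = ?g (y + 0 * i)"
        using y by (subst (1 2) val) simp_all
      then have "0 + 1 * i = y + 0 * i"
        by (rule inj)
      with y i_notin show False
        by simp
    qed
    ultimately show "U\<^sup>2 = 1 \<and> V ^ 3 \<noteq> V" ..
  next
    assume uv: "U\<^sup>2 = 1 \<and> V ^ 3 \<noteq> V"
    have "inj ?g"
    proof (rule injI)
      fix x y
      assume eq: "?g x = ?g y"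
      obtain m k where x: "m ^ 3 = m" "k ^ 3 = k" "x = m + k * i"
        using square_add_1_coordinates[OF card i] .
      obtain n l where y: "n ^ 3 = n" "l ^ 3 = l" "y = n + l * i"
        using square_add_1_coordinates[OF card i] .
      have eq': "m * U + k * V - k\<^sup>2 = n * U + l * V - l\<^sup>2"
        using eq unfolding x(3) y(3) val[OF x(1,2)] val[OF y(1,2)] .
      have "k = l"
      proof (rule ccontr)
        define d where "d = l - k"
        assume "k \<noteq> l"
        have d: "d ^ 3 = d"
          unfolding d_def by (simp only: cube_diff[OF 3] x(2) y(2))
        moreover have "d \<noteq> 0"
          using \<open>k \<noteq> l\<close> by (simp add: d_def)
        ultimately have "d\<^sup>2 = 1"
          by (auto simp: cube_eq_self_iff)
        \<comment> \<open>Collecting the multiples of \<open>V\<close> in \<open>eq'\<close>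
          expresses \<open>d * V\<close> by elements of the prime field; dividing by
          \<open>d\<close> would put \<open>V\<close> there too.\<close>
        define w where "w = (m - n) * U - k\<^sup>2 + l\<^sup>2"
        have "w = d * V"
          unfolding w_def d_def using eq' by algebra
        then have v: "V = d * w"
          using \<open>d\<^sup>2 = 1\<close> by algebra
        have u3: "U ^ 3 = U"
          using uv by (simp add: power3_eq_cube power2_eq_square)
        have "(k\<^sup>2) ^ 3 = k\<^sup>2" "(l\<^sup>2) ^ 3 = l\<^sup>2"
          using x(2) y(2) by (metis power_mult mult.commute)+
        then have "w ^ 3 = w"
          by (simp only: w_def cube_add[OF 3] cube_diff[OF 3] power_mult_distrib x(1) y(1) u3)
        then have "V ^ 3 = V"
          using v d by (simp add: power_mult_distrib)
        with uv show False
          by simp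
      qed
      moreover have "U \<noteq> 0"
        using uv by auto
      ultimately show "x = y"
        using eq' x y by simp
    qed
    then show "bij ?g"
      by (simp add: bij_def finite_UNIV_inj_surj)
  qed
  then show ?thesis
    by (simp only: U_def V_def)
qed

section \<open>Coefficient conditions from Hermite's criterion\<close>

text \<open>The second and fourth powers, reduced modulo x^9 - x, must have zero coefficient at x^8.
  This yields \<open>2 * a\<^sub>2 + a\<^sub>4\<^sup>2 = 0\<close> and then
  \<open>1 + a\<^sub>4 ^ 4 + a\<^sub>4 ^ 8 = 0\<close>, where the last power is 1.\<close>

lemma bij_sextic_imp_coeffs:
  fixes a\<^sub>1 a\<^sub>2 a\<^sub>3 a\<^sub>4 :: "'a::{field,finite}"
  assumes card: "CARD('a) = 9"
    and bij: "bij (\<lambda>x. x ^ 6 + a\<^sub>4 * x ^ 4 + a\<^sub>3 * x ^ 3 + a\<^sub>2 * x\<^sup>2 + a\<^sub>1 * x)" (is "bij ?f")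
  shows "a\<^sub>2 = a\<^sub>4\<^sup>2" and "a\<^sub>4 ^ 4 = 1"
proof -
  have 3: "(3::'a) = 0"
    using card by (rule three_eq_0)
  have pow: "x ^ 9 = x" for x :: 'a
    using power_card_eq_self[of x] card by simp
  have pow10: "x ^ 10 = x\<^sup>2" for x :: 'a
    using power_add[of x 9 1] pow[of x] by (simp add: power2_eq_square)
  have pow12: "x ^ 12 = x ^ 4" for x :: 'a
    using power_add[of x 9 3] power_add[of x 1 3] pow[of x] by simp
  have pow18: "x ^ 18 = x\<^sup>2" for x :: 'a
    using power_mult[of x 9 2] pow[of x] by simp
  note pow' = pow10 pow12 pow18
  have coeff_8: "c\<^sub>8 = 0"
    if "\<And>x. ?f x ^ k = poly [:c\<^sub>0, c\<^sub>1, c\<^sub>2, c\<^sub>3, c\<^sub>4, c\<^sub>5, c\<^sub>6, c\<^sub>7, c\<^sub>8:] x" and "k < 8"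
    for k c\<^sub>0 c\<^sub>1 c\<^sub>2 c\<^sub>3 c\<^sub>4 c\<^sub>5 c\<^sub>6 c\<^sub>7 c\<^sub>8
  proof -
    let ?p = "[:c\<^sub>0, c\<^sub>1, c\<^sub>2, c\<^sub>3, c\<^sub>4, c\<^sub>5, c\<^sub>6, c\<^sub>7, c\<^sub>8:]"
    have degree_pCons_leI: "degree (pCons c p) \<le> Suc n" if "degree p \<le> n" for c :: 'a and p n
      using degree_pCons_le[of c p] that by linarith
    have "degree ?p \<le> Suc (Suc (Suc (Suc (Suc (Suc (Suc (Suc 0)))))))"
      by (intro degree_pCons_leI) simp
    then have deg: "degree ?p \<le> CARD('a) - 1"
      by (simp add: card del: degree_pCons_eq_if)
    have "0 = (\<Sum>x\<in>UNIV. ?f x ^ k)"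
      using bij_imp_sum_power_eq_0[OF bij, of k] card \<open>k < 8\<close> by simp
    also have "\<dots> = (\<Sum>x\<in>UNIV. poly ?p x)"
      using that(1) by (intro sum.cong) auto
    also have "\<dots> = - coeff ?p 8"
      using sum_poly_eq_neg_coeff[OF deg] card by simp
    also have "coeff ?p 8 = c\<^sub>8"
      by (simp add: numeral_eq_Suc)
    finally show ?thesis
      by simp
  qed
  \<comment> \<open>The list \<open>?p\<close> is the expanded square with x^9, x^10 and x^12 folded
    back to x, x^2 and x^4.\<close>
  have c2: "2 * a\<^sub>2 + a\<^sub>4\<^sup>2 = 0"
  proof (rule coeff_8)
    let ?p = "[:0, 2 * a\<^sub>3, a\<^sub>1\<^sup>2 + 2 * a\<^sub>4, 2 * a\<^sub>2 * a\<^sub>1, a\<^sub>2\<^sup>2 + 2 * a\<^sub>3 * a\<^sub>1 + 1,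
        2 * a\<^sub>4 * a\<^sub>1 + 2 * a\<^sub>3 * a\<^sub>2, 2 * a\<^sub>4 * a\<^sub>2 + a\<^sub>3\<^sup>2, 2 * a\<^sub>1 + 2 * a\<^sub>4 * a\<^sub>3, 2 * a\<^sub>2 + a\<^sub>4\<^sup>2:]"
    fix x
    have "?f x ^ 2 = poly ?p x + (x ^ 12 - x ^ 4) + 2 * a\<^sub>4 * (x ^ 10 - x\<^sup>2) + 2 * a\<^sub>3 * (x ^ 9 - x)"
      unfolding poly_pCons poly_0 by algebra
    then show "?f x ^ 2 = poly ?p x"
      by (simp only: pow pow' diff_self mult_zero_right add_0_right)
  qed simp
  show a2: "a\<^sub>2 = a\<^sub>4\<^sup>2"
    by (rule char_3_eqI[OF 3, of _ _ a\<^sub>2]) (use c2 in algebra)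
  \<comment> \<open>The fourth power is the cube times the polynomial itself. Additivity of cubing
    keeps the cube at five terms, and folding exponents brings its degree down to at most 6.\<close>
  have "1 + a\<^sub>4 ^ 3 * a\<^sub>4 + a\<^sub>2 ^ 3 * a\<^sub>2 = 0"
  proof (rule coeff_8)
    let ?p = "[:0, a\<^sub>2 ^ 3 * a\<^sub>3 + a\<^sub>1 ^ 3, a\<^sub>4 ^ 3 + a\<^sub>3 ^ 3 * a\<^sub>1 + a\<^sub>2 ^ 3 * a\<^sub>4, a\<^sub>1 + a\<^sub>3 ^ 3 * a\<^sub>2,
        a\<^sub>2 + a\<^sub>3 ^ 3 * a\<^sub>3 + a\<^sub>2 ^ 3 + a\<^sub>1 ^ 3 * a\<^sub>1,
        a\<^sub>3 + a\<^sub>4 ^ 3 * a\<^sub>1 + a\<^sub>3 ^ 3 * a\<^sub>4 + a\<^sub>1 ^ 3 * a\<^sub>2, a\<^sub>4 + a\<^sub>4 ^ 3 * a\<^sub>2 + a\<^sub>1 ^ 3 * a\<^sub>3,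
        a\<^sub>4 ^ 3 * a\<^sub>3 + a\<^sub>3 ^ 3 + a\<^sub>2 ^ 3 * a\<^sub>1 + a\<^sub>1 ^ 3 * a\<^sub>4,
        1 + a\<^sub>4 ^ 3 * a\<^sub>4 + a\<^sub>2 ^ 3 * a\<^sub>2:]"
    fix x
    have "?f x ^ 3 = x ^ 18 + a\<^sub>4 ^ 3 * x ^ 12 + a\<^sub>3 ^ 3 * x ^ 9 + a\<^sub>2 ^ 3 * x ^ 6 + a\<^sub>1 ^ 3 * x ^ 3"
      by (simp add: cube_add[OF 3] power_mult_distrib flip: power_mult)
    also have "\<dots> = x\<^sup>2 + a\<^sub>4 ^ 3 * x ^ 4 + a\<^sub>3 ^ 3 * x + a\<^sub>2 ^ 3 * x ^ 6 + a\<^sub>1 ^ 3 * x ^ 3"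
      by (simp only: pow pow')
    finally have cube: "?f x ^ 3 = \<dots>" .
    have "?f x ^ 4 = ?f x ^ 3 * ?f x"
      by algebra
    also have "\<dots> = poly ?p x + a\<^sub>2 ^ 3 * (x ^ 12 - x ^ 4)
        + (a\<^sub>4 ^ 3 + a\<^sub>2 ^ 3 * a\<^sub>4) * (x ^ 10 - x\<^sup>2) + (a\<^sub>2 ^ 3 * a\<^sub>3 + a\<^sub>1 ^ 3) * (x ^ 9 - x)"
      unfolding cube unfolding poly_pCons poly_0 by algebra
    also have "\<dots> = poly ?p x"
      by (simp only: pow pow' diff_self mult_zero_right add_0_right)
    finally show "?f x ^ 4 = poly ?p x" .
  qed simp
  then have c4: "1 + a\<^sub>4 ^ 4 + a\<^sub>4 ^ 8 = 0"
    unfolding a2 by algebra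
  then have "a\<^sub>4 \<noteq> 0"
    by auto
  then have a8: "a\<^sub>4 ^ 8 = 1"
    using power_card_minus_1_eq_1[of a\<^sub>4] card by simp
  show "a\<^sub>4 ^ 4 = 1"
    by (rule char_3_eqI[OF 3, of _ _ "- 1"]) (use c4[unfolded a8] in algebra)
qed

section \<open>Rescaling to the normal form\<close>

text \<open>The fourth roots of unity are 1, -1, \<open>i\<close> and \<open>- i\<close>; they are
  the squares of 1, \<open>i\<close>, \<open>1 - i\<close> and \<open>1 + i\<close> in
  characteristic 3.\<close>

lemma fourth_root_of_unity_is_square:
  fixes c :: "'a::{field,finite}"
  assumes "CARD('a) = 9" and "c ^ 4 = 1"
  obtains a where "c = a\<^sup>2"
proof -
  have 3: "(3::'a) = 0"
    using assms(1) by (rule three_eq_0)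
  obtain i :: 'a where i: "i\<^sup>2 = - 1"
    using imaginary_unit_exists[OF assms(1)] .
  have "(c - 1) * (c + 1) * ((c - i) * (c + i)) = 0"
    using assms(2) i by algebra
  then consider "c = 1" | "c = - 1" | "c = i" | "c = - i"
    by (auto simp: eq_neg_iff_add_eq_0)
  then show thesis
  proof cases
    case 1
    then show thesis
      using that[of 1] by simp
  next
    case 2
    then show thesis
      using that[of i] i by simp
  next
    case 3
    have "i = (1 - i)\<^sup>2"
      by (rule char_3_eqI[OF \<open>3 = 0\<close>, of _ _ i]) (use i in algebra)
    with 3 show thesis
      using that by simp
  next
    case 4
    have "- i = (1 + i)\<^sup>2"
      by (rule char_3_eqI[OF \<open>3 = 0\<close>, of _ _ "- i"]) (use i in algebra)
    with 4 show thesis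
      using that by simp
  qed
qed

text \<open>Substituting \<open>a * x\<close> into the left polynomial gives \<open>a ^ 6\<close>
  times the right one, because \<open>a ^ 8 = 1\<close>; both scalings are bijections.\<close>

lemma bij_scaled_iff:
  fixes a a\<^sub>1 a\<^sub>3 :: "'a::{field,finite}"
  assumes card: "CARD('a) = 9" and "a \<noteq> 0"
  shows "bij (\<lambda>x. x ^ 6 + a\<^sup>2 * x ^ 4 + a\<^sub>3 * x ^ 3 + a ^ 4 * x\<^sup>2 + a\<^sub>1 * x)
    \<longleftrightarrow> bij (\<lambda>x. x ^ 6 + x ^ 4 + a ^ 5 * a\<^sub>3 * x ^ 3 + x\<^sup>2 + a ^ 3 * a\<^sub>1 * x)"
    (is "bij ?f \<longleftrightarrow> bij ?g")
proof -
  have a8: "a ^ 8 = 1"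
    using power_card_minus_1_eq_1[OF \<open>a \<noteq> 0\<close>] card by simp
  have bij_scale: "bij (\<lambda>x. c * x)" if "c \<noteq> 0" for c :: 'a
    using that by (intro o_bij[where g = "\<lambda>x. x / c"]) (auto simp: fun_eq_iff)
  have "?f (a * x) = a ^ 6 * ?g x" for x
  proof -
    have "a ^ 6 * ?g x = ?f (a * x) + (a ^ 8 - 1) * (a ^ 3 * a\<^sub>3 * x ^ 3 + a * a\<^sub>1 * x)"
      by algebra
    with a8 show ?thesis
      by simp
  qed
  then have "?f \<circ> (\<lambda>x. a * x) = (\<lambda>y. a ^ 6 * y) \<circ> ?g"
    by (simp only: fun_eq_iff comp_apply) simp
  moreover have "bij ?f \<longleftrightarrow> bij (?f \<circ> (\<lambda>x. a * x))"
    using \<open>a \<noteq> 0\<close> by (intro bij_betw_comp_iff bij_scale)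
  moreover have "bij ?g \<longleftrightarrow> bij ((\<lambda>y. a ^ 6 * y) \<circ> ?g)"
    using \<open>a \<noteq> 0\<close> by (intro bij_betw_comp_iff2 bij_scale) auto
  ultimately show ?thesis
    by simp
qed

section \<open>The admissible parameters\<close>

text \<open>Since 2 = -1, the roots \<open>s\<close> are \<open>i\<close> and \<open>- i\<close>,
  and the two choices together allow exactly the \<open>t = m + n * i\<close> with \<open>m\<close>
  different from -1. Now \<open>i * (1 + t) = i * (1 + m) - n\<close>, and cubing negates its first
  term and fixes \<open>n\<close>.\<close>

lemma parameter_iff:
  fixes i t :: "'a::{field,finite}"
  assumes card: "CARD('a) = 9" and i: "i\<^sup>2 = - 1"
  shows "(\<exists>s. s ^ 2 - 2 = 0 \<and> t \<in> {0, 1, s, 1 + s}) \<longleftrightarrow> (i * (1 + t)) ^ 3 \<noteq> i * (1 + t)"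
proof -
  have 3: "(3::'a) = 0"
    using card by (rule three_eq_0)
  have two: "2 = (- 1 :: 'a)"
    by (rule char_3_eqI[OF 3, of _ _ 1]) simp
  have roots: "s\<^sup>2 - 2 = 0 \<longleftrightarrow> s = i \<or> s = - i" for s
  proof -
    have "s\<^sup>2 - 2 = 0 \<longleftrightarrow> s\<^sup>2 = i\<^sup>2"
      unfolding i two by (simp add: eq_neg_iff_add_eq_0)
    then show ?thesis
      by (simp add: power2_eq_iff)
  qed
  have lhs: "(\<exists>s. s ^ 2 - 2 = 0 \<and> t \<in> {0, 1, s, 1 + s}) \<longleftrightarrow>
      t \<in> {0, 1, i, 1 + i} \<union> {0, 1, - i, 1 + - i}"
    unfolding roots by blast
  have rhs: "(i * (1 + (m + n * i))) ^ 3 = i * (1 + (m + n * i)) \<longleftrightarrow> m = - 1"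
    if "m ^ 3 = m" "n ^ 3 = n" for m n
  proof -
    have "(1 + m) ^ 3 = 1 + m"
      by (simp add: cube_add[OF 3] that)
    have eq: "i * (1 + (m + n * i)) = i * (1 + m) - n"
      using i by algebra
    have "i ^ 3 = - i"
      using i by (simp add: power3_eq_cube power2_eq_square)
    then have "(i * (1 + m) - n) ^ 3 = - (i * (1 + m)) - n"
      using \<open>(1 + m) ^ 3 = 1 + m\<close> that(2)
      by (simp only: cube_diff[OF 3] power_mult_distrib mult_minus_left)
    then have "(i * (1 + (m + n * i))) ^ 3 = i * (1 + (m + n * i)) \<longleftrightarrow>
        - (i * (1 + m)) = i * (1 + m)"
      unfolding eq by (simp only: diff_right_commute diff_left_imp_eq) auto
    also have "\<dots> \<longleftrightarrow> 1 + m = 0"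
      unfolding minus_eq_self_iff[OF 3] using i by auto
    also have "\<dots> \<longleftrightarrow> m = - 1"
      by (metis add.commute eq_neg_iff_add_eq_0)
    finally show ?thesis .
  qed
  show ?thesis
    unfolding lhs
  proof
    assume "t \<in> {0, 1, i, 1 + i} \<union> {0, 1, - i, 1 + - i}"
    then have "\<exists>m\<in>{0, 1}. \<exists>n\<in>{0, 1, - 1}. t = m + n * i"
      by auto
    then obtain m n where "m \<in> {0, 1}" "n \<in> {0, 1, - 1}" and t: "t = m + n * i"
      by blast
    moreover have "(1::'a) \<noteq> - 1"
      using minus_eq_self_iff[OF 3, of 1] by auto
    ultimately have "m \<noteq> - 1" "m ^ 3 = m" "n ^ 3 = n"
      by (auto simp: cube_eq_self_iff)
    then show "(i * (1 + t)) ^ 3 \<noteq> i * (1 + t)"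
      unfolding t by (simp only: rhs not_False_eq_True)
  next
    assume *: "(i * (1 + t)) ^ 3 \<noteq> i * (1 + t)"
    obtain m n where mn: "m ^ 3 = m" "n ^ 3 = n" and t: "t = m + n * i"
      using square_add_1_coordinates[OF card i] .
    with * have "m \<noteq> - 1"
      by (simp only: rhs not_False_eq_True)
    with mn show "t \<in> {0, 1, i, 1 + i} \<union> {0, 1, - i, 1 + - i}"
      unfolding t cube_eq_self_iff by auto
  qed
qed

section \<open>From the normal form back to the list\<close>

theorem theorem3p11:
  assumes "CARD('a::{field,finite}) = 3 ^ 2"
  shows "{f :: 'a poly. permutation_polynomial f \<and>
            (\<exists>a\<^sub>1 a\<^sub>2 a\<^sub>3 a\<^sub>4.
              f = monom 1 6 + monom a\<^sub>4 4 + monom a\<^sub>3 3 + monom a\<^sub>2 2 + monom a\<^sub>1 1)}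
       = {monom 1 6 + monom (a ^ 2) 4 + monom (a ^ 7 * b) 3 + monom (a ^ 4) 2
            + monom (a * (2 * b + 1)) 1 | a b :: 'a.
            a \<noteq> 0 \<and> (\<exists>s. s ^ 2 - 2 = 0 \<and> b \<in> {0, 1, s, 1 + s})}"
    (is "?L = ?R")
proof -
  have card: "CARD('a) = 9"
    using assms by simp
  have 3: "(3::'a) = 0"
    using card by (rule three_eq_0)
  obtain i :: 'a where i: "i\<^sup>2 = - 1"
    using imaginary_unit_exists[OF card] .
  define F where "F a\<^sub>4 a\<^sub>3 a\<^sub>2 a\<^sub>1 =
      monom 1 6 + monom a\<^sub>4 4 + monom a\<^sub>3 3 + monom a\<^sub>2 2 + monom a\<^sub>1 1"
    for a\<^sub>4 a\<^sub>3 a\<^sub>2 a\<^sub>1 :: 'a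
  have perm_F: "permutation_polynomial (F a\<^sub>4 a\<^sub>3 a\<^sub>2 a\<^sub>1) \<longleftrightarrow>
      bij (\<lambda>x. x ^ 6 + a\<^sub>4 * x ^ 4 + a\<^sub>3 * x ^ 3 + a\<^sub>2 * x\<^sup>2 + a\<^sub>1 * x)" for a\<^sub>4 a\<^sub>3 a\<^sub>2 a\<^sub>1
  proof -
    have "poly (F a\<^sub>4 a\<^sub>3 a\<^sub>2 a\<^sub>1) = (\<lambda>x. x ^ 6 + a\<^sub>4 * x ^ 4 + a\<^sub>3 * x ^ 3 + a\<^sub>2 * x\<^sup>2 + a\<^sub>1 * x)"
      by (simp add: F_def fun_eq_iff poly_monom)
    then show ?thesis
      by (simp add: permutation_polynomial_def)
  qed
  have perm_iff: "permutation_polynomial (F (a\<^sup>2) a\<^sub>3 (a ^ 4) a\<^sub>1) \<longleftrightarrow>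
      (a ^ 5 * a\<^sub>3 + a ^ 3 * a\<^sub>1)\<^sup>2 = 1 \<and>
      (i * (a ^ 3 * a\<^sub>1 - a ^ 5 * a\<^sub>3)) ^ 3 \<noteq> i * (a ^ 3 * a\<^sub>1 - a ^ 5 * a\<^sub>3)"
    if "a \<noteq> 0" for a a\<^sub>1 a\<^sub>3
    unfolding perm_F bij_scaled_iff[OF card that] by (rule bij_normal_form_iff[OF card i])
  \<comment> \<open>Here \<open>d\<close> is 1 or -1, and such a factor does not affect membership
    in the prime field.\<close>
  have good_iff: "(i * (d * (1 + b))) ^ 3 \<noteq> i * (d * (1 + b)) \<longleftrightarrow>
      (\<exists>s. s ^ 2 - 2 = 0 \<and> b \<in> {0, 1, s, 1 + s})" if "d\<^sup>2 = 1" for b d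
  proof -
    have "d ^ 3 = d" "d \<noteq> 0"
      using that by (auto simp: power3_eq_cube power2_eq_square)
    then have "(i * (d * (1 + b))) ^ 3 = d * (i * (1 + b)) ^ 3"
      by (simp add: power_mult_distrib mult.left_commute)
    then have "(i * (d * (1 + b))) ^ 3 = i * (d * (1 + b)) \<longleftrightarrow> (i * (1 + b)) ^ 3 = i * (1 + b)"
      using \<open>d \<noteq> 0\<close> by (simp add: mult.left_commute[of i d])
    then show ?thesis
      using parameter_iff[OF card i, of b] by blast
  qed
  have a8: "a ^ 8 = 1" if "a \<noteq> 0" for a :: 'a
    using power_card_minus_1_eq_1[OF that] card by simp
  show ?thesis
    unfolding F_def[symmetric]
  proof (intro Set.equalityI subsetI)
    fix f
    assume "f \<in> {f. permutation_polynomial f \<and> (\<exists>a\<^sub>1 a\<^sub>2 a\<^sub>3 a\<^sub>4. f = F a\<^sub>4 a\<^sub>3 a\<^sub>2 a\<^sub>1)}"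
    then obtain a\<^sub>1 a\<^sub>2 a\<^sub>3 a\<^sub>4 where f: "f = F a\<^sub>4 a\<^sub>3 a\<^sub>2 a\<^sub>1" and perm: "permutation_polynomial f"
      by auto
    have coeffs: "a\<^sub>2 = a\<^sub>4\<^sup>2" "a\<^sub>4 ^ 4 = 1"
      using bij_sextic_imp_coeffs[OF card] perm unfolding f perm_F by blast+
    obtain a where a: "a\<^sub>4 = a\<^sup>2"
      using fourth_root_of_unity_is_square[OF card coeffs(2)] .
    have "a \<noteq> 0"
      using a coeffs(2) by auto
    have f': "f = F (a\<^sup>2) a\<^sub>3 (a ^ 4) a\<^sub>1"
      by (simp add: f coeffs(1) a flip: power_mult)
    \<comment> \<open>\<open>d\<close> is the quantity \<open>U\<close> of the normal form, a sign
      by the criterion; being its own inverse, it also serves to solve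
      \<open>a ^ 5 * a\<^sub>3 = d * b\<close> for \<open>b\<close>.\<close>
    define d where "d = a ^ 5 * a\<^sub>3 + a ^ 3 * a\<^sub>1"
    define b where "b = d * (a ^ 5 * a\<^sub>3)"
    have d: "d\<^sup>2 = 1"
      using perm unfolding f' perm_iff[OF \<open>a \<noteq> 0\<close>] d_def by blast
    have b_eq: "a ^ 5 * a\<^sub>3 = d * b"
      using d by (simp add: b_def power2_eq_square flip: mult.assoc)
    \<comment> \<open>Characteristic 3 turns 1 - b into the factor \<open>2 * b + 1\<close> of the
      list.\<close>
    have "a ^ 3 * a\<^sub>1 = d - d * b"
      using b_eq d_def by simp
    also have "\<dots> = d * (2 * b + 1)"
      by (rule char_3_eqI[OF 3, of _ _ "- (d * b)"]) algebra
    finally have c_eq: "a ^ 3 * a\<^sub>1 = d * (2 * b + 1)" .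
    have "a ^ 3 * a\<^sub>1 - a ^ 5 * a\<^sub>3 = d * (1 + b)"
      unfolding b_eq c_eq by algebra
    then have b: "\<exists>s. s ^ 2 - 2 = 0 \<and> b \<in> {0, 1, s, 1 + s}"
      using perm good_iff[OF d, of b] unfolding f' perm_iff[OF \<open>a \<noteq> 0\<close>] by simp
    \<comment> \<open>The square root of \<open>a\<^sub>4\<close> is determined up to sign only, and \<open>d\<close> selects the sign.\<close>
    define a' where "a' = d * a ^ 5"
    have "a' \<noteq> 0"
      using \<open>a \<noteq> 0\<close> d by (auto simp: a'_def)
    have "a'\<^sup>2 = d\<^sup>2 * a ^ 8 * a\<^sup>2"
      unfolding a'_def by algebra
    then have a'2: "a'\<^sup>2 = a\<^sup>2"
      using d a8[OF \<open>a \<noteq> 0\<close>] by simp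
    then have a'4: "a' ^ 4 = a ^ 4"
      using power_mult[of a' 2 2] power_mult[of a 2 2] by simp
    \<comment> \<open>\<open>a'\<close> is \<open>a\<close> times the sign \<open>d * a ^ 4\<close>,
      so \<open>a' ^ 7\<close> reduces to \<open>d * a ^ 3\<close>. The factors \<open>a ^ 3\<close>
      and \<open>a ^ 5\<close> are mutually inverse and undo the rescaling of the
      coefficients.\<close>
    have "a' ^ 7 = d * (d\<^sup>2) ^ 3 * (a ^ 8) ^ 4 * a ^ 3"
      unfolding a'_def by algebra
    then have "a' ^ 7 * b = a ^ 3 * (d * b)"
      using d a8[OF \<open>a \<noteq> 0\<close>] by simp
    also have "\<dots> = a ^ 8 * a\<^sub>3"
      unfolding b_eq[symmetric] by algebra
    finally have a3: "a' ^ 7 * b = a\<^sub>3"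
      using a8[OF \<open>a \<noteq> 0\<close>] by simp
    have "a' * (2 * b + 1) = a ^ 5 * (d * (2 * b + 1))"
      unfolding a'_def by algebra
    also have "\<dots> = a ^ 8 * a\<^sub>1"
      unfolding c_eq[symmetric] by algebra
    finally have a1: "a' * (2 * b + 1) = a\<^sub>1"
      using a8[OF \<open>a \<noteq> 0\<close>] by simp
    have "f = F (a'\<^sup>2) (a' ^ 7 * b) (a' ^ 4) (a' * (2 * b + 1))"
      unfolding a'2 a'4 a3 a1 by (rule f')
    then show "f \<in> {F (a\<^sup>2) (a ^ 7 * b) (a ^ 4) (a * (2 * b + 1)) | a b.
        a \<noteq> 0 \<and> (\<exists>s. s\<^sup>2 - 2 = 0 \<and> b \<in> {0, 1, s, 1 + s})}"
      using b \<open>a' \<noteq> 0\<close> by blast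
  next
    fix f
    assume "f \<in> {F (a\<^sup>2) (a ^ 7 * b) (a ^ 4) (a * (2 * b + 1)) | a b.
        a \<noteq> 0 \<and> (\<exists>s. s\<^sup>2 - 2 = 0 \<and> b \<in> {0, 1, s, 1 + s})}"
    then obtain a b where f: "f = F (a\<^sup>2) (a ^ 7 * b) (a ^ 4) (a * (2 * b + 1))"
      and "a \<noteq> 0" and b: "\<exists>s. s\<^sup>2 - 2 = 0 \<and> b \<in> {0, 1, s, 1 + s}"
      by blast
    \<comment> \<open>For a listed polynomial the scaled coefficients are \<open>d * b\<close> and
      \<open>d * (2 * b + 1)\<close> with this sign \<open>d\<close>; their sum is \<open>d\<close>
      modulo 3.\<close>
    define d where "d = a ^ 4"
    have d: "d\<^sup>2 = 1"
      using a8[OF \<open>a \<noteq> 0\<close>] by (simp add: d_def flip: power_mult)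
    have "a ^ 5 * (a ^ 7 * b) = d * d\<^sup>2 * b"
      unfolding d_def by algebra
    then have b_eq: "a ^ 5 * (a ^ 7 * b) = d * b"
      using d by simp
    have c_eq: "a ^ 3 * (a * (2 * b + 1)) = d * (2 * b + 1)"
      unfolding d_def by algebra
    have "d * b + d * (2 * b + 1) = d"
      by (rule char_3_eqI[OF 3, of _ _ "d * b"]) algebra
    moreover have "d * (2 * b + 1) - d * b = d * (1 + b)"
      by algebra
    ultimately have "permutation_polynomial f"
      unfolding f perm_iff[OF \<open>a \<noteq> 0\<close>] b_eq c_eq using d b good_iff[OF d, of b] by simp
    then show "f \<in> {f. permutation_polynomial f \<and> (\<exists>a\<^sub>1 a\<^sub>2 a\<^sub>3 a\<^sub>4. f = F a\<^sub>4 a\<^sub>3 a\<^sub>2 a\<^sub>1)}"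
      using f by blast
  qed
qed

end
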